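(* For every integer $N\ge 0$, $$\beta^+(N)=Z\big(N+S(N)\big),\qquad\text{where } S(N):=\#\{k\ge 1:\ V(k)<N\}\ \text{ and } V(k)=3\lfloor k\varphi\rfloor+k+1 .$$
   Context: Let $\varphi=(1+\sqrt5)/2$. Every integer $N\ge0$ has a unique base phi expansion $N=\sum_{i\in\mathbb Z} d_i(N)\varphi^i$ with $d_i(N)\in\{0,1\}$, finitely many nonzero, and $d_i(N)d_{i+1}(N)=0$ for all $i$. For $N\ge1$ let $L$ be the largest index with $d_L(N)=1$; $\beta^+(N)$ denotes the word $d_L(N)d_{L-1}(N)\cdots d_1(N)d_0(N)$ (the part of the expansion at nonnegative powers). Let $\ddot F_i=F_{i+2}$ ($F_0=0,F_1=1$ Fibonacci numbers), so $\ddot F_0=1,\ddot F_1=2,\ddot F_2=3,\dots$. Every integer $N\ge0$ has a unique Zeckendorf expansion $N=\sum_{i\ge0}e_i\ddot F_i$ with $e_i\in\{0,1\}$ and $e_ie_{i+1}=0$; $Z(N)$ denotes the word $e_L\cdots e_1e_0$ with $e_L$ the leading $1$. For $N=0$ both $\beta^+(0)$ and $Z(0)$ are taken to be the word $0$. *)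

theory Defs
  imports Complex_Main "HOL-Number_Theory.Fib"
begin

definition phi :: real where
  "phi = (1 + sqrt 5) / 2"

definition is_base_phi_expansion :: "nat \<Rightarrow> (int \<Rightarrow> nat) \<Rightarrow> bool" where
  "is_base_phi_expansion N d \<longleftrightarrow>
     (\<forall>i. d i \<in> {0, 1}) \<and> finite {i. d i \<noteq> 0} \<and> (\<forall>i. d i * d (i + 1) = 0) \<and>
     real N = (\<Sum>i | d i \<noteq> 0. real (d i) * phi powi i)"

definition base_phi_digits :: "nat \<Rightarrow> int \<Rightarrow> nat" where
  "base_phi_digits N = (THE d. is_base_phi_expansion N d)"

text \<open>Words are lists of digits, with the most significant digit first.\<close>

definition beta_plus :: "nat \<Rightarrow> nat list" where
  "beta_plus N =
     (if N = 0 then [0]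
      else map (base_phi_digits N) (rev [0..Max {i. base_phi_digits N i = 1}]))"

text \<open>The weight at position \<open>i\<close> is the shifted Fibonacci number \<open>fib (i + 2)\<close>: 1, 2, 3, 5, ...\<close>

definition is_zeckendorf_expansion :: "nat \<Rightarrow> (nat \<Rightarrow> nat) \<Rightarrow> bool" where
  "is_zeckendorf_expansion N e \<longleftrightarrow>
     (\<forall>i. e i \<in> {0, 1}) \<and> finite {i. e i \<noteq> 0} \<and> (\<forall>i. e i * e (i + 1) = 0) \<and>
     N = (\<Sum>i | e i \<noteq> 0. e i * fib (i + 2))"

definition zeckendorf_digits :: "nat \<Rightarrow> nat \<Rightarrow> nat" where
  "zeckendorf_digits N = (THE e. is_zeckendorf_expansion N e)"

definition Z :: "nat \<Rightarrow> nat list" where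
  "Z N =
     (if N = 0 then [0]
      else map (zeckendorf_digits N) (rev [0..<Suc (Max {i. zeckendorf_digits N i = 1})]))"

definition V :: "nat \<Rightarrow> int" where
  "V k = 3 * \<lfloor>real k * phi\<rfloor> + int k + 1"

definition S :: "nat \<Rightarrow> nat" where
  "S N = card {k. k \<ge> 1 \<and> V k < int N}"

end

theory Submission
  imports Defs
begin

text \<open>
  Let \<open>B\<close> be the part of the base phi expansion of \<open>N\<close> at negative powers, and read the remaining digits
  \<open>e\<close> as coefficients of Fibonacci numbers: \<open>a = \<Sum>i. e i * fib i\<close> and \<open>M = \<Sum>i. e i * fib (i + 2)\<close>. Then
  \<open>N = a * phi + M - 2 * a + B\<close>, so \<open>k = M - N\<close> satisfies \<open>k * phi = a - k - B * (phi + 1)\<close>. With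
  \<open>delta = \<Sum>i. e i * (1 - phi) ^ i\<close>, which lies strictly between \<open>-1\<close> and \<open>phi\<close>, one gets
  \<open>N = 3 * a - 2 * k + delta - B\<close>. Since \<open>0 \<le> B < 1\<close>, and \<open>B > phi - 1\<close> forces \<open>e 0 = 0\<close> and hence
  \<open>delta < phi - 1\<close>, these two identities give \<open>V k < N \<le> V (k + 1)\<close> (the left part for \<open>k \<ge> 1\<close>), that is
  \<open>S N = k\<close>.
\<close>

section \<open>Arithmetic of the golden ratio and its irrationality\<close>

lemma phi_square: "phi\<^sup>2 = phi + 1"
proof -
  have "(1 + sqrt 5)\<^sup>2 = 6 + 2 * sqrt 5" by (simp add: power2_sum)
  then show ?thesis by (simp add: phi_def power_divide)
qed

lemma phi_bounds: "3 / 2 < phi" "phi < 2"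
proof -
  have "2 < sqrt 5" by (rule real_less_rsqrt) simp
  moreover have "sqrt 5 < 3" by (rule real_less_lsqrt) simp_all
  ultimately show "3 / 2 < phi" "phi < 2" by (simp_all add: phi_def)
qed

text \<open>Infinite descent: a solution \<open>(p, q)\<close> gives the solution \<open>(q, p - q)\<close>.\<close>

lemma golden_ratio_descent:
  fixes p q :: nat
  assumes "p * p = p * q + q * q"
  shows "q = 0"
  using assms
proof (induction q arbitrary: p rule: less_induct)
  case (less q)
  show ?case
  proof (rule ccontr)
    assume "q \<noteq> 0"
    have "q \<le> p"
    proof (rule ccontr)
      assume "\<not> q \<le> p"
      then have "p * p < q * q" by (intro mult_strict_mono) auto
      then show False using less.prems by simp
    qed
    then obtain r where r: "p = q + r" by (rule le_Suc_ex[THEN exE])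
    have qr: "q * q = q * r + r * r"
      using less.prems by (simp add: r algebra_simps)
    have "r < q"
    proof (rule ccontr)
      assume "\<not> r < q"
      then have "q * q \<le> q * r" "0 < r * r" using \<open>q \<noteq> 0\<close> by auto
      then show False using qr by simp
    qed
    then have "r = 0" using less.IH qr by blast
    then show False using qr \<open>q \<noteq> 0\<close> by simp
  qed
qed

text \<open>Squaring \<open>p = q * phi\<close> and using \<open>phi_square\<close> gives the
  equation of the descent. The lemma later excludes a vanishing negative part \<open>B\<close> when
  \<open>k\<close> is positive.\<close>

lemma phi_irrational:
  assumes "real p = real q * phi"
  shows "q = 0"
proof -
  have "real p * real p = real q * real q * phi\<^sup>2"
    unfolding assms by (simp add: power2_eq_square)
  also have "\<dots> = real p * real q + real q * real q"
    unfolding phi_square assms by (simp add: algebra_simps)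
  finally have "p * p = p * q + q * q"
    by (simp only: of_nat_eq_iff flip: of_nat_mult of_nat_add)
  then show ?thesis by (rule golden_ratio_descent)
qed

section \<open>Digit sequences without adjacent ones\<close>

definition nonadjacent :: "(nat \<Rightarrow> nat) \<Rightarrow> bool" where
  "nonadjacent e \<longleftrightarrow> (\<forall>i. e i \<in> {0, 1}) \<and> (\<forall>i. e i * e (Suc i) = 0)"

lemma nonadjacent_cases:
  assumes "nonadjacent e"
  obtains "e i = 0" | "e i = 1" "e (Suc i) = 0"
proof -
  have "e i \<in> {0, 1}" "e i * e (Suc i) = 0"
    using assms by (auto simp: nonadjacent_def)
  then show ?thesis using that by auto
qed

lemma nonadjacent_shift: "nonadjacent e \<Longrightarrow> nonadjacent (\<lambda>i. e (i + k))"
  by (simp add: nonadjacent_def)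

text \<open>The powers of \<open>phi\<close> and the shifted Fibonacci numbers satisfy the same
  recurrence and start with the same strict increase, so one uniqueness argument serves both
  numeration systems.\<close>

locale fib_weights =
  fixes w :: "nat \<Rightarrow> real"
  assumes w_0: "0 < w 0" and w_1: "w 0 < w 1"
    and w_rec: "w (Suc (Suc n)) = w (Suc n) + w n"
begin

lemma w_pos: "0 < w n" and w_less: "w n < w (Suc n)"
proof -
  have "0 < w n \<and> w n < w (Suc n)"
    using w_0 w_1 w_rec by (induction n) auto
  then show "0 < w n" "w n < w (Suc n)" by auto
qed

text \<open>A leading 1 at position \<open>Suc m\<close> forces a 0 at position \<open>m\<close>.
  The lower digits then contribute less than \<open>w m\<close>, and \<open>w (Suc m) + w m\<close>
  is the next weight.\<close>

lemma nonadjacent_sum_less: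
  assumes "nonadjacent e"
  shows "(\<Sum>i<n. real (e i) * w i) < w n"
proof (induction n rule: less_induct)
  case (less n)
  consider "n = 0" | "n = 1" | m where "n = Suc (Suc m)"
    by (metis One_nat_def not0_implies_Suc)
  then show ?case
  proof cases
    case 1
    then show ?thesis using w_0 by simp
  next
    case 2
    then show ?thesis using w_0 w_1 nonadjacent_cases[OF assms, of 0] by fastforce
  next
    case 3
    have IH: "(\<Sum>i<m. real (e i) * w i) < w m" "(\<Sum>i<Suc m. real (e i) * w i) < w (Suc m)"
      by (rule less.IH; simp add: 3)+
    show ?thesis
    proof (cases "e (Suc m) = 0")
      case True
      then show ?thesis using IH(2) w_less[of "Suc m"] 3 by simp
    next
      case False
      then have "e m = 0" "e (Suc m) = 1"
        using nonadjacent_cases[OF assms, of m] nonadjacent_cases[OF assms, of "Suc m"] by auto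
      then show ?thesis using IH(1) 3 w_rec by simp
    qed
  qed
qed

text \<open>The digits below position \<open>n\<close> contribute a value in
  \<open>[0, w n)\<close>, so the total decides whether digit \<open>n\<close> is 0 or 1; the rest
  follows by induction.\<close>

lemma nonadjacent_sum_inj:
  assumes e: "nonadjacent e" and f: "nonadjacent f"
    and eq: "(\<Sum>i<n. real (e i) * w i) = (\<Sum>i<n. real (f i) * w i)"
    and "i < n"
  shows "e i = f i"
  using eq \<open>i < n\<close>
proof (induction n)
  case 0
  then show ?case by simp
next
  case (Suc n)
  have nonneg: "0 \<le> (\<Sum>i<n. real (g i) * w i)" for g
    using w_pos by (intro sum_nonneg) (simp add: less_imp_le)
  have less: "(\<Sum>i<n. real (e i) * w i) < w n" "(\<Sum>i<n. real (f i) * w i) < w n"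
    using e f by (simp_all add: nonadjacent_sum_less)
  have "e n \<in> {0, 1}" "f n \<in> {0, 1}"
    using e f by (auto simp: nonadjacent_def)
  then have "e n = f n"
    using Suc.prems(1) less nonneg[of e] nonneg[of f] by auto
  then show ?case
    using Suc by (auto simp: less_Suc_eq)
qed

end

interpretation phi_weights: fib_weights "\<lambda>i. phi ^ i"
proof
  fix n
  have "phi ^ Suc (Suc n) = phi\<^sup>2 * phi ^ n" by (simp add: power2_eq_square)
  then show "phi ^ Suc (Suc n) = phi ^ Suc n + phi ^ n"
    unfolding phi_square by (simp add: algebra_simps)
qed (use phi_bounds in auto)

interpretation zeckendorf_weights: fib_weights "\<lambda>i. real (fib (i + 2))"
proof
  fix n
  show "real (fib (Suc (Suc n) + 2)) = real (fib (Suc n + 2)) + real (fib (n + 2))"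
    by simp
next
  have "fib (0 + 2) = 1" "fib (1 + 2) = 2"
    by (simp_all add: numeral_3_eq_3 numeral_2_eq_2)
  then show "0 < real (fib (0 + 2))" "real (fib (0 + 2)) < real (fib (1 + 2))"
    by (simp_all only:)
qed

section \<open>Power sums at \<open>phi\<close> and at its conjugate \<open>1 - phi\<close>\<close>

text \<open>This is \<open>x ^ n = fib n * x + fib (n - 1)\<close>, with the last term rewritten as
  \<open>fib (n + 2) - 2 * fib n\<close>: no index becomes negative at 0, and the Zeckendorf weight
  \<open>fib (n + 2)\<close> appears. It applies to both roots of
  \<open>x\<^sup>2 = x + 1\<close>.\<close>

lemma fib_linearization:
  fixes x :: real
  assumes "x\<^sup>2 = x + 1"
  shows "x ^ n = real (fib n) * x + real (fib (n + 2)) - 2 * real (fib n)"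
proof (induction n)
  case (Suc n)
  have "x ^ Suc n = real (fib n) * x\<^sup>2 + (real (fib (n + 2)) - 2 * real (fib n)) * x"
    unfolding power_Suc Suc by (simp add: algebra_simps power2_eq_square)
  also have "\<dots> = real (fib (Suc n)) * x + real (fib n)"
    unfolding assms by (simp add: algebra_simps)
  finally show ?case by simp
qed simp

lemma sum_fib_linearization:
  fixes x :: real and e :: "nat \<Rightarrow> nat"
  assumes "x\<^sup>2 = x + 1"
  shows "(\<Sum>i<n. real (e i) * x ^ i) =
    real (\<Sum>i<n. e i * fib i) * x + real (\<Sum>i<n. e i * fib (i + 2)) - 2 * real (\<Sum>i<n. e i * fib i)"
proof (induction n)
  case (Suc n)
  show ?case
    unfolding sum.lessThan_Suc Suc.IH fib_linearization[OF assms, of n]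
    by (simp add: algebra_simps)
qed simp

text \<open>Splitting off digit 0 turns the tail value \<open>T\<close> into
  \<open>e 0 - (phi - 1) * T\<close>. As \<open>(phi - 1) * phi = 1\<close>, this map sends the
  interval from \<open>-1\<close> to \<open>phi\<close> into the one from \<open>-1\<close> to
  \<open>phi - 1\<close> if \<open>e 0 = 0\<close>, and into the one from \<open>0\<close> to
  \<open>phi\<close> if \<open>e 0 = 1\<close>. The limits \<open>-1\<close> and \<open>phi\<close>
  are approached by ones at all odd or at all even positions.\<close>

lemma conjugate_sum_bounds:
  assumes "nonadjacent e"
  shows "-1 < (\<Sum>i<n. real (e i) * (1 - phi) ^ i)"
    and "(\<Sum>i<n. real (e i) * (1 - phi) ^ i) < phi"
    and "e 0 = 0 \<Longrightarrow> (\<Sum>i<n. real (e i) * (1 - phi) ^ i) < phi - 1"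
proof -
  have "-1 < (\<Sum>i<n. real (e i) * (1 - phi) ^ i) \<and>
      (\<Sum>i<n. real (e i) * (1 - phi) ^ i) < (if e 0 = 0 then phi - 1 else phi)"
    using assms
  proof (induction n arbitrary: e)
    case 0
    then show ?case using phi_bounds by auto
  next
    case (Suc n)
    define T where "T = (\<Sum>i<n. real (e (i + 1)) * (1 - phi) ^ i)"
    have IH: "-1 < T" "T < (if e 1 = 0 then phi - 1 else phi)"
      using Suc.IH[OF nonadjacent_shift[OF Suc.prems, of 1]] by (auto simp: T_def)
    have "(\<Sum>i<Suc n. real (e i) * (1 - phi) ^ i) = real (e 0) + (1 - phi) * T"
      unfolding sum.lessThan_Suc_shift T_def sum_distrib_left by (simp add: mult_ac)
    then have step: "(\<Sum>i<Suc n. real (e i) * (1 - phi) ^ i) = real (e 0) - (phi - 1) * T"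
      by (simp add: algebra_simps)
    have "T < phi" using IH(2) phi_bounds by (auto split: if_splits)
    have lower: "(phi - 1) * T > - (phi - 1)"
      using mult_strict_left_mono[OF IH(1), of "phi - 1"] phi_bounds by simp
    have "(phi - 1) * phi = 1" using phi_square by (simp add: power2_eq_square algebra_simps)
    then have upper: "(phi - 1) * T < 1"
      using mult_strict_left_mono[OF \<open>T < phi\<close>, of "phi - 1"] phi_bounds by simp
    show ?case
      using nonadjacent_cases[OF Suc.prems, of 0] step lower upper phi_bounds by force
  qed
  then show "-1 < (\<Sum>i<n. real (e i) * (1 - phi) ^ i)"
    "(\<Sum>i<n. real (e i) * (1 - phi) ^ i) < phi"
    "e 0 = 0 \<Longrightarrow> (\<Sum>i<n. real (e i) * (1 - phi) ^ i) < phi - 1"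
    by (auto split: if_splits)
qed

section \<open>Existence and uniqueness of Zeckendorf expansions\<close>

text \<open>Greedy algorithm: once \<open>fib (Suc m + 2)\<close> is subtracted, the remainder is
  below \<open>fib (m + 2)\<close>, so its digits vanish from position \<open>m\<close> on and the
  new 1 at \<open>Suc m\<close> has no neighbour.\<close>

lemma zeckendorf_exists_bounded:
  assumes "M < fib (n + 2)"
  shows "\<exists>e. nonadjacent e \<and> (\<forall>i\<ge>n. e i = 0) \<and> M = (\<Sum>i<n. e i * fib (i + 2))"
  using assms
proof (induction n arbitrary: M rule: less_induct)
  case (less n)
  consider "M = 0" | "n = 1" "M = 1" | m where "n = Suc (Suc m)"
    using less.prems by (cases n; cases "n - 1") (auto simp: less_Suc_eq numeral_2_eq_2)
  then show ?case
  proof cases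
    case 1
    then show ?thesis by (intro exI[of _ "\<lambda>_. 0"]) (simp add: nonadjacent_def)
  next
    case 2
    then show ?thesis
      by (intro exI[of _ "\<lambda>i. if i = 0 then 1 else 0"]) (auto simp: nonadjacent_def)
  next
    case 3
    show ?thesis
    proof (cases "M < fib (Suc m + 2)")
      case True
      then obtain e where "nonadjacent e" "\<forall>i\<ge>Suc m. e i = 0" "M = (\<Sum>i<Suc m. e i * fib (i + 2))"
        using less.IH[of "Suc m" M] 3 by blast
      then show ?thesis by (intro exI[of _ e]) (auto simp: 3)
    next
      case False
      then have "M - fib (Suc m + 2) < fib (m + 2)"
        using less.prems 3 by simp
      then obtain e where e: "nonadjacent e" "\<forall>i\<ge>m. e i = 0"
        "M - fib (Suc m + 2) = (\<Sum>i<m. e i * fib (i + 2))"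
        using less.IH[of m] 3 by auto
      have "nonadjacent (e(Suc m := 1))"
        using e(1,2) by (auto simp: nonadjacent_def)
      moreover have "M = (\<Sum>i<n. (e(Suc m := 1)) i * fib (i + 2))"
        using e(2,3) False by (simp add: 3)
      ultimately show ?thesis
        using e(2) by (intro exI[of _ "e(Suc m := 1)"]) (auto simp: 3 simp del: fun_upd_apply, simp)
    qed
  qed
qed

lemma zeckendorf_exists:
  obtains e n where "nonadjacent e" "\<forall>i\<ge>n. e i = 0" "M = (\<Sum>i<n. e i * fib (i + 2))"
proof -
  have "M < fib (M + 2)"
  proof (induction M)
    case (Suc M)
    have "0 < fib (Suc M)" by (rule fib_neq_0_nat) simp
    then show ?case using Suc by simp
  qed simp
  then show ?thesis using zeckendorf_exists_bounded that by blast
qed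

lemma zeckendorf_digits_eq:
  assumes e: "nonadjacent e" "\<forall>i\<ge>n. e i = 0"
  shows "zeckendorf_digits (\<Sum>i<n. e i * fib (i + 2)) = e"
  unfolding zeckendorf_digits_def
proof (rule the_equality)
  have less: "i < n" if "e i \<noteq> 0" for i
    using e(2) that by (meson leI)
  then have fin: "finite {i. e i \<noteq> 0}"
    by (meson finite_nat_set_iff_bounded mem_Collect_eq)
  have "{i. e i \<noteq> 0} \<subseteq> {..<n}" using less by blast
  then have "(\<Sum>i<n. e i * fib (i + 2)) = (\<Sum>i | e i \<noteq> 0. e i * fib (i + 2))"
    by (intro sum.mono_neutral_right) auto
  then show "is_zeckendorf_expansion (\<Sum>i<n. e i * fib (i + 2)) e"
    using e(1) fin by (simp add: is_zeckendorf_expansion_def nonadjacent_def)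
next
  fix f assume "is_zeckendorf_expansion (\<Sum>i<n. e i * fib (i + 2)) f"
  then have f: "nonadjacent f" "finite {i. f i \<noteq> 0}"
    and sum: "(\<Sum>i<n. e i * fib (i + 2)) = (\<Sum>i | f i \<noteq> 0. f i * fib (i + 2))"
    by (auto simp: is_zeckendorf_expansion_def nonadjacent_def)
  obtain m where m: "\<forall>i\<in>{i. f i \<noteq> 0}. i < m"
    using finite_nat_set_iff_bounded f(2) by blast
  \<comment> \<open>Both sums are padded with zero digits to a common range, where
    \<open>nonadjacent_sum_inj\<close> applies.\<close>
  have "(\<Sum>i<n. e i * fib (i + 2)) = (\<Sum>i<max m n. e i * fib (i + 2))"
    using e(2) by (intro sum.mono_neutral_left) auto
  moreover have "(\<Sum>i | f i \<noteq> 0. f i * fib (i + 2)) = (\<Sum>i<max m n. f i * fib (i + 2))"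
    using m by (intro sum.mono_neutral_left) (auto simp: less_max_iff_disj)
  ultimately have "(\<Sum>i<max m n. f i * fib (i + 2)) = (\<Sum>i<max m n. e i * fib (i + 2))"
    using sum by simp
  then have "(\<Sum>i<max m n. real (f i) * real (fib (i + 2))) = (\<Sum>i<max m n. real (e i) * real (fib (i + 2)))"
    by (simp flip: of_nat_mult of_nat_sum del: fib.simps add_2_eq_Suc')
  then have "f i = e i" if "i < max m n" for i
    by (rule zeckendorf_weights.nonadjacent_sum_inj[OF f(1) e(1) _ that])
  moreover have "f i = e i" if "\<not> i < max m n" for i
    using m e(2) that by (auto simp: not_less)
  ultimately show "f = e" by blast
qed

section \<open>Existence and uniqueness of base phi expansions\<close>

text \<open>Scaling by \<open>phi ^ m\<close> clears the negative powers, so that results on digit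
  sequences indexed by naturals carry over to expansions indexed by integers.\<close>

lemma base_phi_sum:
  fixes d :: "int \<Rightarrow> nat"
  assumes "\<And>i. d i \<noteq> 0 \<Longrightarrow> - int m \<le> i \<and> i < int n"
  shows "phi ^ m * (\<Sum>i | d i \<noteq> 0. real (d i) * phi powi i) =
    (\<Sum>i<m + n. real (d (int i - int m)) * phi ^ i)"
proof -
  have "(\<Sum>i | d i \<noteq> 0. real (d i) * phi powi i) = (\<Sum>i\<in>{- int m..<int n}. real (d i) * phi powi i)"
    using assms by (intro sum.mono_neutral_left) auto
  also have "\<dots> = (\<Sum>i<m + n. real (d (int i - int m)) * phi powi (int i - int m))"
    by (rule sum.reindex_bij_witness[of _ "\<lambda>i. int i - int m" "\<lambda>i. nat (i + int m)"]) auto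
  also have "phi ^ m * \<dots> = (\<Sum>i<m + n. real (d (int i - int m)) * phi ^ i)"
    using phi_bounds unfolding sum_distrib_left
    by (intro sum.cong) (auto simp: power_int_diff)
  finally show ?thesis .
qed

lemma finite_int_bounded:
  fixes X :: "int set"
  assumes "finite X"
  obtains m where "\<And>i. i \<in> X \<Longrightarrow> - int m \<le> i \<and> i < int m"
proof
  fix i assume "i \<in> X"
  then have "nat \<bar>i\<bar> \<le> Max ((\<lambda>i. nat \<bar>i\<bar>) ` X)"
    using assms by simp
  then show "- int (Suc (Max ((\<lambda>i. nat \<bar>i\<bar>) ` X))) \<le> i \<and> i < int (Suc (Max ((\<lambda>i. nat \<bar>i\<bar>) ` X)))"
    by linarith
qed

lemma nonadjacent_of_base_phi:
  "is_base_phi_expansion N d \<Longrightarrow> nonadjacent (\<lambda>i. d (int i - int m))"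
  unfolding is_base_phi_expansion_def nonadjacent_def
proof (intro conjI allI; elim conjE)
  fix i assume "\<forall>i. d i * d (i + 1) = 0"
  moreover have "int (Suc i) - int m = int i - int m + 1" by simp
  ultimately show "d (int i - int m) * d (int (Suc i) - int m) = 0" by metis
qed blast

lemma base_phi_unique:
  assumes d: "is_base_phi_expansion N d" and d': "is_base_phi_expansion N d'"
  shows "d = d'"
proof -
  have "finite ({i. d i \<noteq> 0} \<union> {i. d' i \<noteq> 0})"
    using d d' by (simp add: is_base_phi_expansion_def)
  then obtain m where m: "\<And>i. i \<in> {i. d i \<noteq> 0} \<union> {i. d' i \<noteq> 0} \<Longrightarrow> - int m \<le> i \<and> i < int m"
    using finite_int_bounded by metis
  have "(\<Sum>i<m + m. real (d (int i - int m)) * phi ^ i) = phi ^ m * real N"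
    "(\<Sum>i<m + m. real (d' (int i - int m)) * phi ^ i) = phi ^ m * real N"
    using d d' m by (subst base_phi_sum[symmetric]; force simp: is_base_phi_expansion_def)+
  then have eq: "d (int i - int m) = d' (int i - int m)" if "i < m + m" for i
    by (intro phi_weights.nonadjacent_sum_inj[OF nonadjacent_of_base_phi[OF d] nonadjacent_of_base_phi[OF d'] _ that]) simp
  show ?thesis
  proof
    fix i
    show "d i = d' i"
    proof (cases "- int m \<le> i \<and> i < int m")
      case True
      then have "nat (i + int m) < m + m" "int (nat (i + int m)) - int m = i" by linarith+
      then show ?thesis using eq[of "nat (i + int m)"] by simp
    next
      case False
      then show ?thesis using m[of i] by fastforce
    qed
  qed
qed

text \<open>\<open>N * phi ^ p = a * phi + M - 2 * a\<close> has a small conjugate \<open>N * (1 - phi) ^ p\<close> for large even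
  \<open>p\<close>. Reading the Zeckendorf digits of \<open>M\<close> in base \<open>phi\<close> gives \<open>a' * phi + M - 2 * a'\<close>, and comparing
  conjugates forces \<open>a' = a\<close>.\<close>

lemma base_phi_exists: "\<exists>d. is_base_phi_expansion N d"
proof -
  obtain m where m: "real N < phi ^ m"
    using real_arch_pow[of phi "real N"] phi_bounds by auto
  \<comment> \<open>Evenness makes the conjugate nonnegative. One factor
    \<open>(phi - 1) ^ m\<close> is bounded by 1, the other outweighs
    \<open>N < phi ^ m\<close>.\<close>
  define p where "p = 2 * m"
  define a where "a = N * fib p"
  define M where "M = N * fib (p + 2)"
  have conj: "(1 - phi)\<^sup>2 = (1 - phi) + 1"
    using phi_square by (simp add: power2_eq_square algebra_simps)
  have val: "real N * x ^ p = real a * x + real M - 2 * real a" if "x\<^sup>2 = x + 1" for x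
    unfolding fib_linearization[OF that, of p] by (simp add: a_def M_def algebra_simps)
  obtain e n where e: "nonadjacent e" "\<forall>i\<ge>n. e i = 0" "M = (\<Sum>i<n. e i * fib (i + 2))"
    by (rule zeckendorf_exists)
  define a' where "a' = (\<Sum>i<n. e i * fib i)"
  have val': "(\<Sum>i<n. real (e i) * x ^ i) = real a' * x + real M - 2 * real a'" if "x\<^sup>2 = x + 1" for x
    using sum_fib_linearization[OF that] by (simp add: a'_def e(3))
  have small: "0 \<le> real N * (1 - phi) ^ p" "real N * (1 - phi) ^ p < 1"
  proof -
    show "0 \<le> real N * (1 - phi) ^ p" by (simp add: p_def)
    have "(phi - 1) * phi = 1"
      using phi_square by (simp add: power2_eq_square algebra_simps)
    then have one: "(phi - 1) ^ m * phi ^ m = 1" by (simp flip: power_mult_distrib)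
    have le: "(phi - 1) ^ m \<le> 1" "0 < (phi - 1) ^ m" using phi_bounds by (auto intro: power_le_one)
    have "(1 - phi) ^ p = (phi - 1) ^ m * (phi - 1) ^ m"
      unfolding p_def power_mult power2_commute[of 1 phi]
      by (simp add: power2_eq_square power_mult_distrib)
    then have "real N * (1 - phi) ^ p \<le> real N * (phi - 1) ^ m"
      using le by (simp add: mult_left_mono mult_left_le)
    also have "\<dots> < phi ^ m * (phi - 1) ^ m" using m le by simp
    finally show "real N * (1 - phi) ^ p < 1" using one by (simp add: mult.commute)
  qed
  have "a = a'"
  proof -
    \<comment> \<open>\<open>t\<close> is the difference of the two conjugates, hence of absolute
      value below 2, while \<open>1 + phi\<close> exceeds 2. The integer \<open>a' - a\<close> must
      then be 0.\<close>
    define t where "t = (real a' - real a) * (1 + phi)"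
    have "t = real N * (1 - phi) ^ p - (\<Sum>i<n. real (e i) * (1 - phi) ^ i)"
      unfolding val[OF conj] val'[OF conj] t_def by (simp add: algebra_simps)
    then have t: "-2 < t" "t < 2"
      using small conjugate_sum_bounds(1,2)[OF e(1), of n] phi_bounds by linarith+
    have "\<not> 1 \<le> real a' - real a"
    proof
      assume "1 \<le> real a' - real a"
      then have "1 * (1 + phi) \<le> t"
        unfolding t_def using phi_bounds by (intro mult_right_mono) auto
      then show False using t phi_bounds by simp
    qed
    moreover have "\<not> real a' - real a \<le> -1"
    proof
      assume "real a' - real a \<le> -1"
      then have "t \<le> -1 * (1 + phi)"
        unfolding t_def using phi_bounds by (intro mult_right_mono) auto
      then show False using t phi_bounds by simp
    qed
    ultimately show ?thesis by linarith
  qed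
  then have eq: "real N * phi ^ p = (\<Sum>i<n. real (e i) * phi ^ i)"
    using val[OF phi_square] val'[OF phi_square] by simp
  \<comment> \<open>Shifting the digits down by \<open>p\<close> divides by \<open>phi ^ p\<close>.
    The default 0 is essential: below \<open>- int p\<close>, \<open>nat\<close> would truncate the
    index to 0 and repeat \<open>e 0\<close>.\<close>
  define d where "d i = (if - int p \<le> i then e (nat (i + int p)) else 0)" for i
  have supp: "- int p \<le> i \<and> i < int n" if "d i \<noteq> 0" for i
  proof -
    have "- int p \<le> i" "e (nat (i + int p)) \<noteq> 0"
      using that by (auto simp: d_def split: if_splits)
    moreover from this have "nat (i + int p) < n"
      using e(2) by (meson leI)
    ultimately show ?thesis by linarith
  qed
  have "phi ^ p * (\<Sum>i | d i \<noteq> 0. real (d i) * phi powi i) = (\<Sum>i<p + n. real (e i) * phi ^ i)"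
    by (subst base_phi_sum[of d p n, OF supp]) (simp_all add: d_def)
  also have "\<dots> = (\<Sum>i<n. real (e i) * phi ^ i)"
    using e(2) by (intro sum.mono_neutral_right) auto
  finally have "phi ^ p * (\<Sum>i | d i \<noteq> 0. real (d i) * phi powi i) = phi ^ p * real N"
    using eq by (simp only: mult.commute[of "phi ^ p" "real N"])
  then have "real N = (\<Sum>i | d i \<noteq> 0. real (d i) * phi powi i)"
    using phi_bounds by simp
  moreover have "finite {i. d i \<noteq> 0}"
  proof (rule finite_subset)
    show "{i. d i \<noteq> 0} \<subseteq> {- int p..<int n}"
    proof
      fix i assume "i \<in> {i. d i \<noteq> 0}"
      then have "d i \<noteq> 0" by blast
      from supp[OF this] show "i \<in> {- int p..<int n}" by simp
    qed
  qed simp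
  moreover have "d i \<in> {0, 1}" for i
    using e(1) by (simp add: d_def nonadjacent_def)
  moreover have "d i * d (i + 1) = 0" for i
  proof (cases "- int p \<le> i")
    case True
    then have "nat (i + 1 + int p) = Suc (nat (i + int p))" by linarith
    then show ?thesis using e(1) True by (simp add: d_def nonadjacent_def)
  qed (simp add: d_def)
  ultimately have "is_base_phi_expansion N d"
    by (simp add: is_base_phi_expansion_def)
  then show ?thesis by blast
qed

lemma base_phi_digits: "is_base_phi_expansion N (base_phi_digits N)"
proof -
  obtain d where d: "is_base_phi_expansion N d" using base_phi_exists by blast
  show ?thesis
    unfolding base_phi_digits_def
    by (rule theI[of "is_base_phi_expansion N", OF d]) (rule base_phi_unique[OF _ d])
qed

section \<open>Locating \<open>N\<close> among the values of \<open>V\<close>\<close>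

lemma V_strict_mono: "strict_mono V"
proof (rule strict_monoI)
  fix j k :: nat assume "j < k"
  then have "\<lfloor>real j * phi\<rfloor> \<le> \<lfloor>real k * phi\<rfloor>"
    using phi_bounds by (intro floor_mono mult_right_mono) auto
  then show "V j < V k" using \<open>j < k\<close> by (simp add: V_def)
qed

text \<open>Monotonicity of \<open>V\<close> makes the counted set the initial segment
  \<open>{1..k}\<close>. The first premise is restricted to \<open>k \<ge> 1\<close> because
  \<open>V 0 = 1\<close> is not counted and need not lie below \<open>N\<close>.\<close>

lemma S_eqI:
  assumes "k \<ge> 1 \<Longrightarrow> V k < int N" and "int N \<le> V (Suc k)"
  shows "S N = k"
proof -
  have "{j. j \<ge> 1 \<and> V j < int N} = {1..k}"
  proof (intro set_eqI iffI)
    fix j assume "j \<in> {j. j \<ge> 1 \<and> V j < int N}"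
    then have "j \<ge> 1" "V j < V (Suc k)" using assms(2) by auto
    then show "j \<in> {1..k}" using strict_mono_less[OF V_strict_mono, of j "Suc k"] by simp
  next
    fix j assume j: "j \<in> {1..k}"
    then have "V j \<le> V k" using strict_mono_less_eq[OF V_strict_mono] by simp
    then show "j \<in> {j. j \<ge> 1 \<and> V j < int N}" using j assms(1) by auto
  qed
  then show ?thesis by (simp add: S_def)
qed

text \<open>The negative part enters as a real number \<open>B\<close> known only through its range
  and the link between a large \<open>B\<close> and digit 0. The floors in \<open>V\<close> are
  estimated from \<open>k * phi\<close>, and \<open>N\<close> itself from
  \<open>delta\<close>.\<close>

lemma S_of_expansion:
  fixes N :: nat and e f :: "nat \<Rightarrow> nat" and m n :: nat
  assumes e: "nonadjacent e"
  defines "A \<equiv> (\<Sum>i<n. real (e i) * phi ^ i)" and "M \<equiv> (\<Sum>i<n. e i * fib (i + 2))"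
  assumes N: "real N = A + B" and B: "0 \<le> B" "B < 1"
    and B_large: "phi - 1 < B \<Longrightarrow> e 0 = 0"
  shows "M = N + S N"
proof -
  define a where "a = (\<Sum>i<n. e i * fib i)"
  define delta where "delta = (\<Sum>i<n. real (e i) * (1 - phi) ^ i)"
  define k where "k = int M - int N"
  have conj: "(1 - phi)\<^sup>2 = (1 - phi) + 1"
    using phi_square by (simp add: power2_eq_square algebra_simps)
  have A: "A = real a * phi + real M - 2 * real a"
    unfolding A_def M_def a_def by (rule sum_fib_linearization[OF phi_square])
  have delta: "delta = real a * (1 - phi) + real M - 2 * real a"
    unfolding delta_def M_def a_def by (rule sum_fib_linearization[OF conj])
  have k: "real_of_int k = 2 * real a - real a * phi - B"
    using N A by (simp add: k_def)
  have N_eq: "real N = 3 * real a - 2 * real_of_int k + delta - B"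
    using N A k delta by (simp add: algebra_simps)
  have "real_of_int k * phi = 2 * (real a * phi) - real a * phi\<^sup>2 - B * phi"
    unfolding k by (simp add: algebra_simps power2_eq_square)
  also have "\<dots> = real a - real_of_int k - B * (phi + 1)"
    unfolding phi_square k by (simp add: algebra_simps)
  finally have k_phi: "real_of_int k * phi = real a - real_of_int k - B * (phi + 1)" .
  have delta_bounds: "-1 < delta" "delta < phi" "phi - 1 < B \<Longrightarrow> delta < phi - 1"
    using conjugate_sum_bounds[OF e, of n] B_large by (auto simp: delta_def)
  \<comment> \<open>By the formula for \<open>k\<close>, this and \<open>B < 1\<close> give
    \<open>k > -1\<close>, so \<open>k\<close> is a natural number and can be a count.\<close>
  have "0 \<le> real a * (2 - phi)" using phi_bounds by simp
  then have "-1 < real_of_int k" using k B by (simp add: algebra_simps)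
  then have "0 \<le> k" by linarith
  then obtain K where K: "k = int K" by (rule nonneg_int_cases)
  have "V K < int N" if "K \<ge> 1"
  proof -
    \<comment> \<open>\<open>B = 0\<close> would make \<open>K * phi\<close> an integer. Strict
      positivity of \<open>B\<close> is what lowers the floor of \<open>K * phi\<close> to at most
      \<open>a - K - 1\<close>.\<close>
    have "B \<noteq> 0"
    proof
      assume "B = 0"
      then have eq: "real K * phi = real a - real K"
        using k_phi K by simp
      moreover have "0 \<le> real K * phi" using phi_bounds by simp
      ultimately have "K \<le> a" by simp
      then have "K = 0"
        using eq phi_irrational[of "a - K" K] by simp
      then show False using that by simp
    qed
    then have "0 < B * (phi + 1)" using B phi_bounds by simp
    then have "real K * phi < of_int (int a - int K)" using k_phi K by simp
    then have "\<lfloor>real K * phi\<rfloor> < int a - int K" by (simp only: floor_less_iff)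
    then have "V K \<le> 3 * int a - 2 * int K - 2" by (simp add: V_def)
    moreover have "real_of_int (3 * int a - 2 * int K - 2) < real N"
      using N_eq K B delta_bounds by simp
    then have "3 * int a - 2 * int K - 2 < int N" by linarith
    ultimately show ?thesis by simp
  qed
  moreover have "int N \<le> V (Suc K)"
  proof (cases "phi - 1 < B")
    case True
    \<comment> \<open>For large \<open>B\<close> the floor is only known to be at least
      \<open>a - K - 1\<close>. The loss of 3 in \<open>V\<close> is compensated by
      \<open>delta < phi - 1 < B\<close>, which puts \<open>N\<close> below
      \<open>3 * a - 2 * K\<close>.\<close>
    have "B * (phi + 1) < 1 * (phi + 1)"
      using B phi_bounds by (intro mult_strict_right_mono) auto
    then have "of_int (int a - int K - 1) \<le> real (Suc K) * phi"
      using k_phi K by (simp add: algebra_simps)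
    then have "int a - int K - 1 \<le> \<lfloor>real (Suc K) * phi\<rfloor>" by (simp only: le_floor_iff)
    then have "3 * int a - 2 * int K - 1 \<le> V (Suc K)" by (simp add: V_def)
    moreover have "real N < of_int (3 * int a - 2 * int K)"
      using N_eq K True delta_bounds by simp
    then have "int N < 3 * int a - 2 * int K" by linarith
    ultimately show ?thesis by simp
  next
    case False
    \<comment> \<open>The threshold \<open>phi - 1\<close> is the value of \<open>B\<close> at which
      \<open>B * (phi + 1)\<close> reaches \<open>phi\<close>, the amount gained in passing from
      \<open>K\<close> to \<open>Suc K\<close>. Up to it the floor is at least \<open>a - K\<close>,
      and \<open>delta - B < 2\<close> suffices.\<close>
    then have "B * (phi + 1) \<le> (phi - 1) * (phi + 1)"
      using phi_bounds by (intro mult_right_mono) auto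
    also have "\<dots> = phi"
      using phi_square by (simp add: algebra_simps power2_eq_square)
    finally have "of_int (int a - int K) \<le> real (Suc K) * phi"
      using k_phi K by (simp add: algebra_simps)
    then have "int a - int K \<le> \<lfloor>real (Suc K) * phi\<rfloor>" by (simp only: le_floor_iff)
    then have "3 * int a - 2 * int K + 2 \<le> V (Suc K)" by (simp add: V_def)
    moreover have "real N < of_int (3 * int a - 2 * int K + 2)"
      using N_eq K B delta_bounds phi_bounds by simp
    then have "int N < 3 * int a - 2 * int K + 2" by linarith
    ultimately show ?thesis by simp
  qed
  ultimately have "S N = K" by (rule S_eqI)
  then show ?thesis using K by (simp add: k_def)
qed

lemma sum_lessThan_add:
  fixes f :: "nat \<Rightarrow> real"
  shows "(\<Sum>i<m + n. f i) = (\<Sum>i<m. f i) + (\<Sum>i<n. f (m + i))"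
proof (induction n)
  case (Suc n)
  show ?case by (simp only: add_Suc_right sum.lessThan_Suc Suc.IH add.assoc)
qed simp

text \<open>Cutting the scaled expansion at position \<open>m\<close> separates the negative powers
  from the others; what remains is to verify the hypotheses of \<open>S_of_expansion\<close> for the
  negative part.\<close>

lemma base_phi_integer_part:
  assumes d: "is_base_phi_expansion N d" and supp: "\<And>i. d i \<noteq> 0 \<Longrightarrow> - int m \<le> i \<and> i < int n"
  shows "(\<Sum>i<n. d (int i) * fib (i + 2)) = N + S N"
proof -
  define f where "f i = d (int i - int m)" for i
  have f: "nonadjacent f"
    unfolding f_def using nonadjacent_of_base_phi[OF d] .
  have e: "nonadjacent (\<lambda>i. d (int i))"
    using nonadjacent_of_base_phi[OF d, of 0] by simp
  define B where "B = (\<Sum>i<m. real (f i) * phi ^ i) / phi ^ m"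
  have pos: "0 < phi ^ m" for m using phi_bounds by simp
  have "phi ^ m * real N = (\<Sum>i<m + n. real (f i) * phi ^ i)"
    using d base_phi_sum[of d m n, OF supp] by (simp add: f_def is_base_phi_expansion_def)
  also have "\<dots> = phi ^ m * B + phi ^ m * (\<Sum>i<n. real (d (int i)) * phi ^ i)"
  proof -
    have "phi ^ m * B = (\<Sum>i<m. real (f i) * phi ^ i)" using phi_bounds by (simp add: B_def)
    moreover have "phi ^ m * (\<Sum>i<n. real (d (int i)) * phi ^ i) = (\<Sum>i<n. real (f (m + i)) * phi ^ (m + i))"
      by (simp add: f_def sum_distrib_left power_add mult_ac)
    ultimately show ?thesis unfolding sum_lessThan_add by simp
  qed
  finally have N: "real N = (\<Sum>i<n. real (d (int i)) * phi ^ i) + B"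
    using phi_bounds by (simp flip: distrib_left)
  have "0 \<le> B"
    unfolding B_def using phi_bounds by (intro divide_nonneg_nonneg sum_nonneg) auto
  moreover have "B < 1"
    unfolding B_def using phi_weights.nonadjacent_sum_less[OF f, of m] pos[of m] by simp
  moreover have "d 0 = 0" if large: "phi - 1 < B"
  proof (rule ccontr)
    assume "d 0 \<noteq> 0"
    show False
    proof (cases m)
      case 0
      then show False using large phi_bounds by (simp add: B_def)
    next
      case (Suc q)
      \<comment> \<open>A 1 at position 0 forces a 0 at position -1. The negative part then starts
        at position -2 at the earliest and stays below
        \<open>phi ^ q / phi ^ m = phi - 1\<close>.\<close>
      have "d (-1) * d 0 = 0"
        using d by (metis add.left_inverse is_base_phi_expansion_def)
      then have "f q = 0" using \<open>d 0 \<noteq> 0\<close> by (simp add: f_def Suc)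
      then have "(\<Sum>i<m. real (f i) * phi ^ i) < phi ^ q"
        using phi_weights.nonadjacent_sum_less[OF f, of q] by (simp add: Suc)
      also have "phi ^ q = ((phi - 1) * phi) * phi ^ q"
        using phi_square by (simp add: power2_eq_square algebra_simps)
      also have "\<dots> = (phi - 1) * phi ^ m" by (simp add: Suc)
      finally show False
        using large unfolding B_def pos_less_divide_eq[OF pos] by simp
    qed
  qed
  ultimately show ?thesis
    by (intro S_of_expansion[OF e N]) simp_all
qed

section \<open>Equality of the two words\<close>

lemma upto_int: "[0..int n] = map int [0..<Suc n]"
proof (induction n)
  case (Suc n)
  have "[0..int (Suc n)] = [0..int n] @ [int (Suc n)]"
    using upto_rec2[of 0 "int (Suc n)"] by simp
  then show ?case using Suc by simp
qed simp

theorem theorem2p1: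
  fixes N :: nat
  shows "beta_plus N = Z (N + S N)"
proof (cases "N = 0")
  case True
  have "V k < 0 \<longleftrightarrow> False" for k
    using phi_bounds by (simp add: V_def not_less)
  then show ?thesis using True by (simp add: beta_plus_def Z_def S_def)
next
  case False
  define d where "d = base_phi_digits N"
  have d: "is_base_phi_expansion N d"
    unfolding d_def by (rule base_phi_digits)
  define e where "e i = d (int i)" for i
  have fin: "finite {i. d i \<noteq> 0}"
    using d by (simp add: is_base_phi_expansion_def)
  obtain m where m: "\<And>i. d i \<noteq> 0 \<Longrightarrow> - int m \<le> i \<and> i < int m"
    using finite_int_bounded[OF fin] by auto
  have e: "nonadjacent e" "\<forall>i\<ge>m. e i = 0"
  proof -
    show "nonadjacent e"
      using nonadjacent_of_base_phi[OF d, of 0] by (simp add: e_def[abs_def])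
    show "\<forall>i\<ge>m. e i = 0"
      using m unfolding e_def by (metis not_le of_nat_le_iff)
  qed
  have M: "(\<Sum>i<m. e i * fib (i + 2)) = N + S N"
    unfolding e_def using d m by (rule base_phi_integer_part)
  have Z_digits: "zeckendorf_digits (N + S N) = e"
    using zeckendorf_digits_eq[OF e] by (simp only: M)
  \<comment> \<open>If all digits at nonnegative positions vanished, \<open>N + S N\<close> would be
    0. With a 1 among them, the negative positions cannot affect the leading index, and both words
    have the same length.\<close>
  have "\<exists>i. e i = 1"
  proof (rule ccontr)
    assume "\<nexists>i. e i = 1"
    then have "\<forall>i. e i = 0" using e(1) by (auto simp: nonadjacent_def)
    then show False using M False by simp
  qed
  moreover have fin_e: "finite {i. e i = 1}"
    unfolding finite_nat_set_iff_bounded using e(2) by (metis leI mem_Collect_eq zero_neq_one)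
  ultimately have L: "Max {i. e i = 1} \<in> {i. e i = 1}"
    by (intro Max_in) auto
  have "Max {i. d i = 1} = int (Max {i. e i = 1})"
  proof (rule Max_eqI)
    show "finite {i. d i = 1}" by (rule finite_subset[OF _ fin]) auto
    show "int (Max {i. e i = 1}) \<in> {i. d i = 1}" using L by (simp add: e_def)
    fix i assume i: "i \<in> {i. d i = 1}"
    show "i \<le> int (Max {i. e i = 1})"
    proof (cases "i \<ge> 0")
      case True
      then have "nat i \<le> Max {i. e i = 1}"
        using i fin_e by (intro Max_ge) (auto simp: e_def)
      then show ?thesis by simp
    qed simp
  qed
  then have "beta_plus N = map d (rev (map int [0..<Suc (Max {i. e i = 1})]))"
    using False by (simp add: beta_plus_def d_def[symmetric] upto_int del: upt_Suc)
  also have "\<dots> = map e (rev [0..<Suc (Max {i. e i = 1})])"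
    unfolding e_def by (simp add: rev_map comp_def del: upt_Suc)
  also have "\<dots> = Z (N + S N)"
    using False by (simp add: Z_def Z_digits del: upt_Suc)
  finally show ?thesis .
qed

end
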